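(* For all non-negative integers $m$ and $k$, $$\sum_{n=0}^m \binom{m}{n}\binom{m+n+k}{m}\binom{2m+n+k}{n+m}^{-1}\frac{m+2n+k+1}{2m+n+k+1}=1.$$
   Context: Here $\binom{a}{b}$ denotes the usual binomial coefficient, and $\binom{a}{b}^{-1}$ its multiplicative inverse (as a rational number). *)

theory Defs
  imports Complex_Main
begin

end

(* Written with factorials, the sum is the very-well-poised 4F3(-1) at a = m+k+1, b = -m, c = m+1.
   Freeing c from the upper summation bound gives a family whose recurrence in that bound has a
   one-term telescoping (WZ) certificate. *)
theory Submission
  imports Defs
begin

text \<open>The theorem has \<open>q\<close> and \<open>M\<close> both equal to \<open>m\<close>;
  they are kept apart so that a recurrence can shift \<open>M\<close> alone, which occurs only in
  the binomial and in the last factorial.\<close>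

definition wp_term :: "nat \<Rightarrow> nat \<Rightarrow> nat \<Rightarrow> nat \<Rightarrow> rat" where
  "wp_term q k M n = of_nat (M choose n) * fact (k + q + n) * fact (q + n) * of_nat (k + q + 1 + 2 * n)
     / (fact (k + n) * fact (k + q + 1 + M + n))"

text \<open>This is \<open>wp_term q k M n\<close> times the rational function (k+q+n+1)(q+n+1) /
  ((k+q+1+2n)(k+q+2+M+n)).\<close>

definition wp_cert :: "nat \<Rightarrow> nat \<Rightarrow> nat \<Rightarrow> nat \<Rightarrow> rat" where
  "wp_cert q k M n = of_nat (M choose n) * fact (k + q + n + 1) * fact (q + n + 1)
     / (fact (k + n) * fact (k + q + 2 + M + n))"

text \<open>Subtracting in the ring rather than in \<open>nat\<close> lets the relation cover
  \<open>n > M\<close> as well, where both binomials vanish.\<close>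

lemma of_nat_binomial_step:
  "of_nat (Suc n) * of_nat (M choose Suc n) = (of_nat M - of_nat n) * (of_nat (M choose n) :: 'a::comm_ring_1)"
proof (cases "n \<le> M")
  case True
  have "Suc n * (M choose Suc n) = (M - n) * (M choose n)"
    by (metis binomial_absorb_comp binomial_absorption mult.commute)
  then have "of_nat (Suc n * (M choose Suc n)) = (of_nat ((M - n) * (M choose n)) :: 'a)"
    by simp
  then show ?thesis
    using True by (simp only: of_nat_mult of_nat_diff)
qed (simp add: binomial_eq_0)

text \<open>Boundary case of the telescoping, with the certificate at index -1 read as 0.\<close>

lemma wp_term_0: "of_nat (k + M + 1) * wp_term q k (Suc M) 0 - wp_term q k M 0 = - wp_cert q k M 0"
  by (simp add: wp_term_def wp_cert_def divide_simps) (simp add: algebra_simps)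

text \<open>All four terms are rational multiples of the same factorials, so clearing denominators
  leaves a polynomial identity modulo the relation between two adjacent binomials.\<close>

lemma wp_term_Suc:
  "of_nat (k + M + 1) * wp_term q k (Suc M) (Suc n) - wp_term q k M (Suc n)
     = wp_cert q k M n - wp_cert q k M (Suc n)"
proof -
  define A B :: rat where "A = of_nat (M choose Suc n)" and "B = of_nat (M choose n)"
  define K Q N M' :: rat where "K = of_nat k" and "Q = of_nat q" and "N = of_nat n" and "M' = of_nat M"
  define P :: rat where "P = fact (k + q + n + 1)"
  define R :: rat where "R = fact (q + n + 1)"
  define S :: rat where "S = fact (k + n)"
  define T :: rat where "T = fact (k + q + 2 + M + n)"
  \<comment> \<open>These are the factors gained when the factorials \<open>S\<close> and
    \<open>T\<close> advance by one.\<close>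
  define U V :: rat where "U = K + N + 1" and "V = K + Q + M' + N + 3"
  have nz: "S \<noteq> 0" "T \<noteq> 0" "U \<noteq> 0" "V \<noteq> 0"
  proof -
    have "U = of_nat (k + n + 1)" "V = of_nat (k + q + M + n + 3)"
      by (simp_all add: U_def V_def K_def Q_def M'_def N_def)
    then show "U \<noteq> 0" "V \<noteq> 0"
      by (simp_all only: of_nat_eq_0_iff)
  qed (simp_all add: S_def T_def)
  \<comment> \<open>Pascal's rule turns the binomial of \<open>Suc M\<close> into
    \<open>A + B\<close>.\<close>
  have 1: "wp_term q k (Suc M) (Suc n)
      = (A + B) * P * R * (K + Q + 2 * N + 3) / (U * S * (V * T))"
    by (simp add: wp_term_def U_def V_def A_def B_def P_def R_def S_def T_def K_def Q_def M'_def N_def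
        eval_nat_numeral algebra_simps)
  have 2: "wp_term q k M (Suc n) = A * P * R * (K + Q + 2 * N + 3) / (U * S * T)"
    by (simp add: wp_term_def U_def V_def A_def P_def R_def S_def T_def K_def Q_def N_def
        eval_nat_numeral algebra_simps)
  have 3: "wp_cert q k M n = B * P * R / (S * T)"
    by (simp add: wp_cert_def B_def P_def R_def S_def T_def)
  have 4: "wp_cert q k M (Suc n) = A * ((K + Q + N + 2) * P) * ((Q + N + 2) * R)
      / (U * S * (V * T))"
    by (simp add: wp_cert_def U_def V_def A_def P_def R_def S_def T_def K_def Q_def M'_def N_def
        eval_nat_numeral algebra_simps)
  have AB: "(N + 1) * A = (M' - N) * B"
    using of_nat_binomial_step[of n M, where 'a = rat]
    by (simp add: A_def B_def N_def M'_def algebra_simps)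
  \<comment> \<open>Left side minus right side equals
    \<open>(Q + N + 2) * ((M' - N) * B - (N + 1) * A)\<close>, which is zero by
    \<open>AB\<close>.\<close>
  have key: "(K + M' + 1) * (A + B) * (K + Q + 2 * N + 3) - A * (K + Q + 2 * N + 3) * V
      = B * U * V - A * (K + Q + N + 2) * (Q + N + 2)"
    using AB unfolding U_def V_def by algebra
  define D where "D = U * S * (V * T)"
  have D: "D \<noteq> 0"
    using nz by (simp add: D_def)
  have "of_nat (k + M + 1) * wp_term q k (Suc M) (Suc n) - wp_term q k M (Suc n)
      = ((K + M' + 1) * (A + B) * (K + Q + 2 * N + 3)
          - A * (K + Q + 2 * N + 3) * V) * (P * R) / D"
    unfolding 1 2 using nz by (simp add: D_def K_def[symmetric] M'_def[symmetric] field_simps)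
  also have "\<dots> = wp_cert q k M n - wp_cert q k M (Suc n)"
    unfolding 3 4 key using nz by (simp add: D_def field_simps)
  finally show ?thesis .
qed

lemma sum_wp_term_telescope:
  "(\<Sum>n\<le>N. of_nat (k + M + 1) * wp_term q k (Suc M) n - wp_term q k M n) = - wp_cert q k M N"
proof (induction N)
  case 0
  show ?case using wp_term_0 by simp
next
  case (Suc N)
  then show ?case using wp_term_Suc[of k M q N] by simp
qed

text \<open>Summing the telescoped recurrence shows that passing from \<open>M\<close> to
  \<open>Suc M\<close> divides the sum by \<open>k + M + 1\<close>; the single term for
  \<open>M = 0\<close> is q!/k!.\<close>

lemma sum_wp_term: "(\<Sum>n\<le>M. wp_term q k M n) = fact q / fact (k + M)"
proof (induction M)
  case 0
  show ?case by (simp add: wp_term_def divide_simps del: of_nat_add)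
next
  case (Suc M)
  \<comment> \<open>Both sums run to \<open>Suc M\<close>: there \<open>M choose Suc M = 0\<close>
    kills the certificate as well as the extra term of the second sum.\<close>
  have "of_nat (k + M + 1) * (\<Sum>n\<le>Suc M. wp_term q k (Suc M) n) - (\<Sum>n\<le>Suc M. wp_term q k M n)
      = - wp_cert q k M (Suc M)"
    by (simp only: sum_wp_term_telescope[symmetric] sum_subtractf sum_distrib_left)
  moreover have "(\<Sum>n\<le>Suc M. wp_term q k M n) = (\<Sum>n\<le>M. wp_term q k M n)" "wp_cert q k M (Suc M) = 0"
    by (simp_all add: wp_term_def wp_cert_def binomial_eq_0)
  ultimately have "of_nat (k + M + 1) * (\<Sum>n\<le>Suc M. wp_term q k (Suc M) n) = (\<Sum>n\<le>M. wp_term q k M n)"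
    by (simp only: minus_zero right_minus_eq)
  then have "of_nat (k + M + 1) * (\<Sum>n\<le>Suc M. wp_term q k (Suc M) n) = fact q / fact (k + M)"
    by (simp only: Suc.IH)
  moreover have "(of_nat (k + M + 1) :: rat) \<noteq> 0"
    by (simp only: of_nat_eq_0_iff)
  moreover have "(fact (k + Suc M) :: rat) = of_nat (k + M + 1) * fact (k + M)"
    by simp
  ultimately show ?case
    by (metis divide_divide_eq_left mult.commute nonzero_mult_div_cancel_left)
qed

text \<open>The denominator 2m+n+k+1 is absorbed into the factorial (2m+n+k)! of the inverted
  binomial. The prefactor is free of \<open>n\<close> and is the reciprocal of the closed form of
  the sum at \<open>q = M = m\<close>.\<close>

lemma binomial_term_eq_wp_term:
  "of_nat (m choose n) * of_nat ((m + n + k) choose m)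
     * inverse (of_nat ((2 * m + n + k) choose (n + m)))
     * (of_nat (m + 2 * n + k + 1) / of_nat (2 * m + n + k + 1))
   = fact (k + m) / fact m * wp_term m k m n"
proof -
  have 1: "(of_nat ((m + n + k) choose m) :: rat) = fact (k + m + n) / (fact m * fact (k + n))"
    by (subst binomial_fact) (simp_all add: ac_simps)
  have "2 * m + n + k - (n + m) = k + m"
    by simp
  then have 2: "(of_nat ((2 * m + n + k) choose (n + m)) :: rat)
      = fact (2 * m + n + k) / (fact (m + n) * fact (k + m))"
    by (subst binomial_fact) (simp_all add: ac_simps)
  have "k + m + 1 + m + n = Suc (2 * m + n + k)"
    by simp
  then have 3: "(fact (k + m + 1 + m + n) :: rat) = of_nat (2 * m + n + k + 1) * fact (2 * m + n + k)"
    by (simp only: fact_Suc) simp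
  have 4: "k + m + 1 + 2 * n = m + 2 * n + k + 1"
    by simp
  show ?thesis
    unfolding wp_term_def 1 2 3 4 by (simp add: divide_simps del: of_nat_add of_nat_Suc)
qed

theorem mainTheorem2:
  fixes m k :: nat
  shows "(\<Sum>n = 0..m.
            of_nat (m choose n) * of_nat ((m + n + k) choose m)
            * inverse (of_nat ((2 * m + n + k) choose (n + m)))
            * (of_nat (m + 2 * n + k + 1) / of_nat (2 * m + n + k + 1))) = (1 :: rat)"
  unfolding binomial_term_eq_wp_term sum_distrib_left[symmetric] atLeast0AtMost sum_wp_term
  by simp

end
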